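(* Let $\mu>0$ and $\rho>0$ be given, let $L_B(y,x;\mu,\rho)$, $s=s(y,x;\mu,\rho)\in\mathbb{R}^n$ and $z=z(y,x;\mu,\rho)\in\mathbb{R}^n$ be as defined in the context, and let $S=\mathrm{diag}(s)$, $Z=\mathrm{diag}(z)$. Then: (1) Both $s$ and $z$ are differentiable with respect to $y$ and $x$, and $$\nabla_y s=-A(S+Z)^{-1}S,\quad \nabla_y z=A(S+Z)^{-1}Z,\quad \nabla_x s=-\rho(S+Z)^{-1}S,\quad \nabla_x z=\rho(S+Z)^{-1}Z.$$ (2) $L_B(y,x;\mu,\rho)$ is twice continuously differentiable with respect to $y$, with $$\nabla_y L_B(y,x;\mu,\rho)=Az(y,x;\mu,\rho)-\rho b,\qquad \nabla^2_{yy}L_B(y,x;\mu,\rho)=A(S+Z)^{-1}ZA^T,$$ and $L_B(y,x;\mu,\rho)$ is strictly convex with respect to $y$. (3) $L_B(y,x;\mu,\rho)$ is twice continuously differentiable and strictly concave with respect to $x$, with $$\nabla_x L_B(y,x;\mu,\rho)=\rho\,(s(y,x;\mu,\rho)-c+A^Ty),\qquad \nabla^2_{xx}L_B(y,x;\mu,\rho)=-\rho^2(S+Z)^{-1}S.$$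
   Context: $A\in\mathbb{R}^{m\times n}$, $b\in\mathbb{R}^m$, $c\in\mathbb{R}^n$ are given, with $\mathrm{rank}(A)=m$; $A_i$ denotes the $i$th column of $A$. For $\mu>0$, $\rho>0$, $y\in\mathbb{R}^m$, $x\in\mathbb{R}^n$ and $i=1,\dots,n$ define $$s_i(y,x;\mu,\rho)=\tfrac12\Big(\sqrt{(\rho x_i-c_i+A_i^Ty)^2+4\rho\mu}-(\rho x_i-c_i+A_i^Ty)\Big),$$ $$z_i(y,x;\mu,\rho)=\tfrac12\Big(\sqrt{(\rho x_i-c_i+A_i^Ty)^2+4\rho\mu}+(\rho x_i-c_i+A_i^Ty)\Big),$$ and the smooth barrier augmented Lagrangian (SBAL) function $$L_B(y,x;\mu,\rho)=-\rho b^Ty+\sum_{i=1}^n\Big(-\rho\mu\ln s_i(y,x;\mu,\rho)+\tfrac12 z_i(y,x;\mu,\rho)^2-\tfrac12\rho^2x_i^2\Big).$$ For a vector function $f=(f_1,\dots,f_n)$, $\nabla_y f$ (resp. $\nabla_x f$) denotes the matrix whose $i$th column is the gradient of $f_i$ with respect to $y$ (resp. $x$). *)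

theory Defs
  imports "HOL-Analysis.Analysis"
begin

definition diag_matrix :: "real ^ 'n \<Rightarrow> real ^ 'n ^ 'n" where
  "diag_matrix v = (\<chi> i j. if i = j then v $ i else 0)"

text \<open>The gradient matrix of a vector function has the gradients of the components as its
  columns, so it is the transpose of the Jacobian matrix.\<close>

definition has_gradient_matrix ::
    "(real ^ 'k \<Rightarrow> real ^ 'n) \<Rightarrow> real ^ 'n ^ 'k \<Rightarrow> real ^ 'k \<Rightarrow> bool" where
  "has_gradient_matrix f G p \<longleftrightarrow> (\<forall>i. GDERIV (\<lambda>q. f q $ i) p :> column i G)"

definition has_hessian :: "(real ^ 'k \<Rightarrow> real) \<Rightarrow> real ^ 'k ^ 'k \<Rightarrow> real ^ 'k \<Rightarrow> bool" where
  "has_hessian f H p \<longleftrightarrow>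
     (\<exists>g. (\<forall>\<^sub>F q in nhds p. GDERIV f q :> g q) \<and> has_gradient_matrix g H p)"

text \<open>Continuity of \<open>f\<close> and of its gradient follows from their differentiability.\<close>

definition twice_continuously_differentiable :: "(real ^ 'k \<Rightarrow> real) \<Rightarrow> bool" where
  "twice_continuously_differentiable f \<longleftrightarrow>
     (\<exists>H. (\<forall>p. has_hessian f (H p) p) \<and> continuous_on UNIV H)"

definition strictly_convex_on :: "'a::real_vector set \<Rightarrow> ('a \<Rightarrow> real) \<Rightarrow> bool" where
  "strictly_convex_on S f \<longleftrightarrow> convex S \<and>
     (\<forall>p\<in>S. \<forall>q\<in>S. \<forall>t. p \<noteq> q \<longrightarrow> 0 < t \<longrightarrow> t < 1 \<longrightarrow>
        f ((1 - t) *\<^sub>R p + t *\<^sub>R q) < (1 - t) * f p + t * f q)"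

definition strictly_concave_on :: "'a::real_vector set \<Rightarrow> ('a \<Rightarrow> real) \<Rightarrow> bool" where
  "strictly_concave_on S f \<longleftrightarrow> strictly_convex_on S (\<lambda>p. - f p)"

definition sbal_s ::
    "real ^ 'n ^ 'm \<Rightarrow> real ^ 'n \<Rightarrow> real \<Rightarrow> real \<Rightarrow> real ^ 'm \<Rightarrow> real ^ 'n \<Rightarrow> real ^ 'n" where
  "sbal_s A c \<mu> \<rho> y x = (\<chi> i.
     1/2 * (sqrt ((\<rho> * x $ i - c $ i + column i A \<bullet> y)^2 + 4 * \<rho> * \<mu>)
            - (\<rho> * x $ i - c $ i + column i A \<bullet> y)))"

definition sbal_z ::
    "real ^ 'n ^ 'm \<Rightarrow> real ^ 'n \<Rightarrow> real \<Rightarrow> real \<Rightarrow> real ^ 'm \<Rightarrow> real ^ 'n \<Rightarrow> real ^ 'n" where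
  "sbal_z A c \<mu> \<rho> y x = (\<chi> i.
     1/2 * (sqrt ((\<rho> * x $ i - c $ i + column i A \<bullet> y)^2 + 4 * \<rho> * \<mu>)
            + (\<rho> * x $ i - c $ i + column i A \<bullet> y)))"

definition sbal_L ::
    "real ^ 'n ^ 'm \<Rightarrow> real ^ 'm \<Rightarrow> real ^ 'n \<Rightarrow> real \<Rightarrow> real \<Rightarrow> real ^ 'm \<Rightarrow> real ^ 'n \<Rightarrow> real" where
  "sbal_L A b c \<mu> \<rho> y x = - \<rho> * (b \<bullet> y) +
     (\<Sum>i\<in>UNIV. - \<rho> * \<mu> * ln (sbal_s A c \<mu> \<rho> y x $ i)
        + 1/2 * (sbal_z A c \<mu> \<rho> y x $ i)^2 - 1/2 * \<rho>^2 * (x $ i)^2)"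

end

theory Submission
  imports Defs
begin

text \<open>For \<open>t\<^sub>i = \<rho> x\<^sub>i - c\<^sub>i + A\<^sub>i \<bullet> y\<close> let \<open>\<zeta> t\<close> (\<open>pos_root (\<rho>\<mu>) t\<close> below) be the positive root \<open>r\<close> of
  \<open>r\<^sup>2 - t r = \<rho>\<mu>\<close>. Then \<open>z\<^sub>i = \<zeta> t\<^sub>i\<close>, \<open>s\<^sub>i = \<zeta> (- t\<^sub>i)\<close>, \<open>s\<^sub>i z\<^sub>i = \<rho>\<mu>\<close> and \<open>z\<^sub>i - s\<^sub>i = t\<^sub>i\<close>, whence
  \<open>dz\<^sub>i/dt\<^sub>i = z\<^sub>i / (s\<^sub>i + z\<^sub>i)\<close>, and \<open>- \<rho>\<mu> ln s\<^sub>i + z\<^sub>i\<^sup>2 / 2\<close> is an antiderivative of \<open>\<zeta>\<close> at \<open>t\<^sub>i\<close>. So, both in \<open>y\<close>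
  and in \<open>x\<close>, the function \<open>L\<^sub>B\<close> is affine plus a sum of functions of one variable along the
  columns of a matrix of full row rank (\<open>A\<close>, resp. the identity), and strict convexity or
  concavity follows from strict monotonicity of the one-variable derivatives.\<close>

section \<open>Strict convexity of functions of one real variable\<close>

text \<open>By the mean value theorem the graph lies strictly above each tangent away from the point
  of contact. The tangent at a convex combination, evaluated at both end points, yields the
  inequality.\<close>

lemma strictly_convex_on_UNIV_deriv:
  fixes g :: "real \<Rightarrow> real"
  assumes g: "\<And>u. (g has_real_derivative g' u) (at u)" and mono: "strict_mono g'"
  shows "strictly_convex_on UNIV g"
proof -
  have tangent: "g w + g' w * (p - w) < g p" if "p \<noteq> w" for p w
  proof (cases "w < p")
    case True
    then obtain \<xi> where "w < \<xi>" "g p - g w = (p - w) * g' \<xi>"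
      using MVT2[OF True, of g g'] g by blast
    moreover have "(p - w) * g' w < (p - w) * g' \<xi>"
      using True strict_monoD[OF mono \<open>w < \<xi>\<close>] by simp
    ultimately show ?thesis by (simp add: mult.commute)
  next
    case False
    then have "p < w" using that by simp
    then obtain \<xi> where "\<xi> < w" "g w - g p = (w - p) * g' \<xi>"
      using MVT2[OF \<open>p < w\<close>, of g g'] g by blast
    moreover have "(w - p) * g' \<xi> < (w - p) * g' w"
      using \<open>p < w\<close> strict_monoD[OF mono \<open>\<xi> < w\<close>] by simp
    ultimately show ?thesis by (simp add: algebra_simps)
  qed
  have "g ((1 - t) *\<^sub>R p + t *\<^sub>R q) < (1 - t) * g p + t * g q"
    if "p \<noteq> q" "0 < t" "t < 1" for p q t :: real
  proof -
    define w where "w = (1 - t) *\<^sub>R p + t *\<^sub>R q"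
    have pw: "p - w = t * (p - q)" and qw: "q - w = (1 - t) * (q - p)"
      by (simp_all add: w_def algebra_simps)
    then have "p \<noteq> w" "q \<noteq> w" using that by auto
    then have "(1 - t) * (g w + g' w * (p - w)) + t * (g w + g' w * (q - w)) < (1 - t) * g p + t * g q"
      using that by (intro add_strict_mono mult_strict_left_mono tangent) auto
    \<comment> \<open>The slope terms cancel because the weighted sum of \<open>p - w\<close> and
      \<open>q - w\<close> is zero.\<close>
    also have "(1 - t) * (g w + g' w * (p - w)) + t * (g w + g' w * (q - w)) = g w"
      unfolding pw qw by (simp add: algebra_simps)
    finally show ?thesis unfolding w_def .
  qed
  then show ?thesis by (simp add: strictly_convex_on_def)
qed

section \<open>Diagonal matrices and their inverses\<close>

text \<open>\<open>matrix_inv\<close> is a choice among two-sided inverses. By associativity there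
  is at most one, so exhibiting one evaluates the choice.\<close>

lemma matrix_inv_unique:
  fixes A B :: "real ^ 'n ^ 'n"
  assumes "A ** B = mat 1" "B ** A = mat 1"
  shows "matrix_inv A = B"
proof -
  have "A ** matrix_inv A = mat 1 \<and> matrix_inv A ** A = mat 1"
    unfolding matrix_inv_def using assms by (rule someI[of "\<lambda>B. A ** B = mat 1 \<and> B ** A = mat 1", OF conjI])
  then have inv: "matrix_inv A ** A = mat 1" ..
  have "matrix_inv A = matrix_inv A ** (A ** B)"
    unfolding assms(1) by simp
  also have "\<dots> = B"
    unfolding matrix_mul_assoc inv by simp
  finally show ?thesis .
qed

lemma diag_matrix_mult:
  "diag_matrix u ** diag_matrix v = diag_matrix (\<chi> i. u $ i * v $ i)"
  by (simp add: diag_matrix_def matrix_matrix_mult_def vec_eq_iff if_distrib[of "\<lambda>x. x * _"]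
      cong: if_cong)

lemma diag_matrix_add: "diag_matrix u + diag_matrix v = diag_matrix (u + v)"
  by (simp add: diag_matrix_def vec_eq_iff)

lemma scaleR_diag_matrix: "r *\<^sub>R diag_matrix v = diag_matrix (r *\<^sub>R v)"
  by (simp add: diag_matrix_def vec_eq_iff)

lemma diag_matrix_inverse:
  assumes "\<And>i. v $ i \<noteq> 0"
  shows "invertible (diag_matrix v)" "matrix_inv (diag_matrix v) = diag_matrix (\<chi> i. inverse (v $ i))"
proof -
  have "diag_matrix v ** diag_matrix (\<chi> i. inverse (v $ i)) = mat 1"
    "diag_matrix (\<chi> i. inverse (v $ i)) ** diag_matrix v = mat 1"
    unfolding diag_matrix_mult using assms by (auto simp: diag_matrix_def mat_def vec_eq_iff)
  then show "invertible (diag_matrix v)" "matrix_inv (diag_matrix v) = diag_matrix (\<chi> i. inverse (v $ i))"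
    by (auto simp: invertible_def intro: matrix_inv_unique)
qed

lemma column_mult_diag_matrix: "column i (M ** diag_matrix v) = v $ i *\<^sub>R column i M"
  by (simp add: column_def diag_matrix_def matrix_matrix_mult_def vec_eq_iff
      if_distrib[of "\<lambda>x. _ * x"] cong: if_cong)

lemma transpose_mult_vec_nth: "(transpose M *v w) $ i = column i M \<bullet> w"
  unfolding matrix_vector_mult_def transpose_def column_def inner_vec_def by simp

section \<open>Gradients, Hessians and convexity of sums of ridge functions\<close>

lemma GDERIV_inner_left: "GDERIV (\<lambda>q. a \<bullet> q) p :> a"
  unfolding gderiv_def by (auto intro!: derivative_eq_intros simp: inner_commute)

lemma GDERIV_ridge:
  assumes "(g has_real_derivative d) (at (a \<bullet> p))"
  shows "GDERIV (\<lambda>q. g (a \<bullet> q)) p :> d *\<^sub>R a"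
  by (rule GDERIV_DERIV_compose[OF GDERIV_inner_left assms])

lemma GDERIV_sum:
  assumes "\<And>i. i \<in> I \<Longrightarrow> GDERIV (f i) p :> d i"
  shows "GDERIV (\<lambda>q. \<Sum>i\<in>I. f i q) p :> (\<Sum>i\<in>I. d i)"
  using assms unfolding gderiv_def inner_sum_right by (rule has_derivative_sum)

text \<open>The chain rule turns each component's gradient into a multiple of a column of
  \<open>M\<close>, and scaling columns is right multiplication by a diagonal matrix.\<close>

lemma has_gradient_matrix_ridge:
  fixes M :: "real ^ 'n ^ 'k"
  assumes "\<And>i. (h i has_real_derivative v $ i) (at (column i M \<bullet> p))"
  shows "has_gradient_matrix (\<lambda>q. \<chi> i. h i (column i M \<bullet> q)) (M ** diag_matrix v) p"
  using GDERIV_ridge[OF assms] by (simp add: has_gradient_matrix_def column_mult_diag_matrix)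

text \<open>The constant \<open>C\<close> takes up the terms of the Lagrangian that depend only on
  the variable held fixed.\<close>

definition ridge_sum ::
    "real ^ 'n ^ 'k \<Rightarrow> real ^ 'k \<Rightarrow> real \<Rightarrow> ('n \<Rightarrow> real \<Rightarrow> real) \<Rightarrow> real ^ 'k \<Rightarrow> real" where
  "ridge_sum M l C g p = l \<bullet> p + C + (\<Sum>i\<in>UNIV. g i (column i M \<bullet> p))"

lemma GDERIV_ridge_sum:
  fixes M :: "real ^ 'n ^ 'k"
  assumes "\<And>i u. (g i has_real_derivative g' i u) (at u)"
  shows "GDERIV (ridge_sum M l C g) p :> (l + M *v (\<chi> i. g' i (column i M \<bullet> p)))"
proof -
  have "GDERIV (\<lambda>q. l \<bullet> q + C + (\<Sum>i\<in>UNIV. g i (column i M \<bullet> q))) p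
      :> (l + 0 + (\<Sum>i\<in>UNIV. g' i (column i M \<bullet> p) *\<^sub>R column i M))"
    by (intro GDERIV_add GDERIV_inner_left GDERIV_const GDERIV_sum GDERIV_ridge assms)
  then show ?thesis
    by (simp add: ridge_sum_def[abs_def] matrix_mult_sum scalar_mult_eq_scaleR)
qed

text \<open>Component \<open>j\<close> of the gradient is again a constant plus a sum of ridge
  functions, now with coefficients \<open>M $ j $ i\<close>. Its gradient is therefore column
  \<open>j\<close> of the triple product.\<close>

lemma has_hessian_ridge_sum:
  fixes M :: "real ^ 'n ^ 'k"
  assumes g: "\<And>i u. (g i has_real_derivative g' i u) (at u)"
    and g': "\<And>i u. (g' i has_real_derivative g'' i u) (at u)"
  shows "has_hessian (ridge_sum M l C g)
    (M ** diag_matrix (\<chi> i. g'' i (column i M \<bullet> p)) ** transpose M) p"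
proof -
  have "GDERIV (\<lambda>q. (l + M *v (\<chi> i. g' i (column i M \<bullet> q))) $ j) p
      :> column j (M ** diag_matrix (\<chi> i. g'' i (column i M \<bullet> p)) ** transpose M)" for j
  proof -
    have "GDERIV (\<lambda>q. l $ j + (\<Sum>i\<in>UNIV. M $ j $ i * g' i (column i M \<bullet> q))) p
        :> (0 + (\<Sum>i\<in>UNIV. (M $ j $ i * g'' i (column i M \<bullet> p)) *\<^sub>R column i M))"
      by (intro GDERIV_add GDERIV_const GDERIV_sum GDERIV_ridge[where g="\<lambda>u. M $ j $ i * g' i u" for i]
          DERIV_cmult g')
    also have "(0 + (\<Sum>i\<in>UNIV. (M $ j $ i * g'' i (column i M \<bullet> p)) *\<^sub>R column i M)) =
        column j (M ** diag_matrix (\<chi> i. g'' i (column i M \<bullet> p)) ** transpose M)"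
      by (simp add: vec_eq_iff column_def transpose_def matrix_matrix_mult_def diag_matrix_def
          if_distrib[of "\<lambda>x. _ * x"] ac_simps cong: if_cong)
    finally show ?thesis by (simp add: matrix_vector_mult_def)
  qed
  \<comment> \<open>The gradient formula holds at every point, hence in particular near
    \<open>p\<close>.\<close>
  then show ?thesis
    unfolding has_hessian_def has_gradient_matrix_def
    by (intro exI[of _ "\<lambda>q. l + M *v (\<chi> i. g' i (column i M \<bullet> q))"])
      (simp add: GDERIV_ridge_sum[OF g])
qed

text \<open>The Hessian depends on the point only through its diagonal factor, so its continuity
  reduces to that of each \<open>g'' i\<close>.\<close>

lemma twice_continuously_differentiable_ridge_sum:
  fixes M :: "real ^ 'n ^ 'k"
  assumes g: "\<And>i u. (g i has_real_derivative g' i u) (at u)"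
    and g': "\<And>i u. (g' i has_real_derivative g'' i u) (at u)"
    and cont: "\<And>i. continuous_on UNIV (g'' i)"
  shows "twice_continuously_differentiable (ridge_sum M l C g)"
proof -
  have "continuous_on UNIV (\<lambda>p. g'' i (column i M \<bullet> p))" for i
    by (rule continuous_on_compose2[OF cont]) (auto intro!: continuous_intros)
  then have "continuous_on UNIV
      (\<lambda>p. M ** diag_matrix (\<chi> i. g'' i (column i M \<bullet> p)) ** transpose M)"
    by (simp add: matrix_matrix_mult_def diag_matrix_def if_distrib[of "\<lambda>x. _ * x"] cong: if_cong)
      (auto intro!: continuous_intros)
  then show ?thesis
    unfolding twice_continuously_differentiable_def
    by (intro exI[of _ "\<lambda>p. M ** diag_matrix (\<chi> i. g'' i (column i M \<bullet> p)) ** transpose M"] conjI allI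
        has_hessian_ridge_sum[OF g g'])
qed

text \<open>Full row rank makes \<open>transpose M\<close> injective, so some column of
  \<open>M\<close> separates two given distinct points. Its summand gives a strict inequality, and
  the others contribute weak ones.\<close>

lemma strictly_convex_on_ridge_sum:
  fixes M :: "real ^ 'n ^ 'k"
  assumes conv: "\<And>i. strictly_convex_on UNIV (g i)" and rank: "rank M = CARD('k)"
  shows "strictly_convex_on UNIV (ridge_sum M l C g)"
proof -
  have "ridge_sum M l C g ((1 - t) *\<^sub>R p + t *\<^sub>R q) < (1 - t) * ridge_sum M l C g p + t * ridge_sum M l C g q"
    if "p \<noteq> q" "0 < t" "t < 1" for p q t
  proof -
    define a where "a i = column i M" for i
    have g: "g i ((1 - t) * u + t * v) < (1 - t) * g i u + t * g i v" if "u \<noteq> v" for i u v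
      using conv[of i] \<open>0 < t\<close> \<open>t < 1\<close> that by (auto simp: strictly_convex_on_def)
    \<comment> \<open>Columns orthogonal to \<open>p - q\<close> give equal arguments, where
      strictness fails and equality holds.\<close>
    have g_le: "g i ((1 - t) * u + t * v) \<le> (1 - t) * g i u + t * g i v" for i u v
      using g[of u v i] by (cases "u = v") (auto simp: algebra_simps)
    have "transpose M *v p \<noteq> transpose M *v q"
      using rank full_rank_injective[of "transpose M"] \<open>p \<noteq> q\<close>
      by (metis rank_transpose injD)
    then obtain i where i: "a i \<bullet> p \<noteq> a i \<bullet> q"
      unfolding a_def by (metis vec_eq_iff transpose_mult_vec_nth)
    have "(\<Sum>i\<in>UNIV. g i (a i \<bullet> ((1 - t) *\<^sub>R p + t *\<^sub>R q))) <
        (\<Sum>i\<in>UNIV. (1 - t) * g i (a i \<bullet> p) + t * g i (a i \<bullet> q))"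
      using g g_le i by (intro sum_strict_mono_ex1) (auto simp: inner_add_right)
    moreover have "(1 - t) * ridge_sum M l C g p + t * ridge_sum M l C g q =
        l \<bullet> ((1 - t) *\<^sub>R p + t *\<^sub>R q) + C + (\<Sum>i\<in>UNIV. (1 - t) * g i (a i \<bullet> p) + t * g i (a i \<bullet> q))"
      by (simp add: ridge_sum_def a_def inner_add_right sum.distrib sum_distrib_left distrib_left)
        (simp add: algebra_simps)
    ultimately show ?thesis
      by (simp add: ridge_sum_def a_def)
  qed
  then show ?thesis by (simp add: strictly_convex_on_def)
qed

section \<open>The positive root function, its derivative and its antiderivative\<close>

definition pos_root :: "real \<Rightarrow> real \<Rightarrow> real" where
  "pos_root k t = (sqrt (t\<^sup>2 + 4 * k) + t) / 2"

lemma pos_root_uminus: "pos_root k (- t) = (sqrt (t\<^sup>2 + 4 * k) - t) / 2"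
  by (simp add: pos_root_def)

context
  fixes k :: real
  assumes k: "k > 0"
begin

lemma pos_root_pos: "pos_root k t > 0"
proof -
  have "\<bar>t\<bar> < sqrt (t\<^sup>2 + 4 * k)"
    using k by (intro real_less_rsqrt) auto
  then show ?thesis by (auto simp: pos_root_def)
qed

lemma pos_root_sum_pos: "pos_root k (- t) + pos_root k t > 0"
  by (intro add_pos_pos pos_root_pos)

text \<open>A difference of squares: the square of the radical minus \<open>t\<^sup>2\<close> leaves
  \<open>4 * k\<close>.\<close>

lemma pos_root_mult: "pos_root k (- t) * pos_root k t = k"
proof -
  have "sqrt (t\<^sup>2 + 4 * k) * sqrt (t\<^sup>2 + 4 * k) = t\<^sup>2 + 4 * k"
    using k by (intro real_sqrt_mult_self[THEN trans]) simp
  then show ?thesis by (simp add: pos_root_def field_simps power2_eq_square)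
qed

text \<open>The denominator equals the radical \<open>sqrt (t\<^sup>2 + 4 * k)\<close> that direct
  differentiation produces.\<close>

lemma has_real_derivative_pos_root:
  "(pos_root k has_real_derivative pos_root k t / (pos_root k (- t) + pos_root k t)) (at t)"
proof -
  have pos: "0 < t\<^sup>2 + 4 * k" using k by (simp add: add_nonneg_pos)
  then have "((\<lambda>t. (sqrt (t\<^sup>2 + 4 * k) + t) / 2) has_real_derivative
      (t / sqrt (t\<^sup>2 + 4 * k) + 1) / 2) (at t)"
    by (auto intro!: derivative_eq_intros simp: field_simps)
  moreover have "(t / sqrt (t\<^sup>2 + 4 * k) + 1) / 2 = pos_root k t / (pos_root k (- t) + pos_root k t)"
    using pos by (simp add: pos_root_def field_simps)
  ultimately show ?thesis by (simp add: pos_root_def[abs_def])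
qed

lemma has_real_derivative_pos_root_uminus:
  "((\<lambda>t. pos_root k (- t)) has_real_derivative - (pos_root k (- t) / (pos_root k (- t) + pos_root k t))) (at t)"
  using DERIV_chain2[OF has_real_derivative_pos_root[of "- t"] DERIV_minus[OF DERIV_ident]]
  by (simp add: add.commute)

text \<open>With \<open>s\<close> and \<open>z\<close> the roots at \<open>- t\<close> and
  \<open>t\<close>, the logarithm contributes \<open>k / (s + z)\<close> and the square contributes
  \<open>z * z / (s + z)\<close>. Since \<open>k = s * z\<close>, the sum collapses to
  \<open>z\<close>.\<close>

lemma has_real_derivative_barrier:
  "((\<lambda>t. - k * ln (pos_root k (- t)) + 1/2 * (pos_root k t)\<^sup>2) has_real_derivative pos_root k t) (at t)"
proof -
  define s z where "s = pos_root k (- t)" and "z = pos_root k t"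
  have "s > 0" "z > 0" by (simp_all add: s_def z_def pos_root_pos)
  have "((\<lambda>t. ln (pos_root k (- t))) has_real_derivative 1 / s * - (s / (s + z))) (at t)"
    unfolding s_def z_def
    by (rule DERIV_chain2[OF DERIV_ln_divide[OF pos_root_pos] has_real_derivative_pos_root_uminus])
  moreover have "((\<lambda>t. (pos_root k t)\<^sup>2) has_real_derivative 2 * (z / (s + z) * z)) (at t)"
    using DERIV_power[OF has_real_derivative_pos_root, of 2 t] by (simp add: s_def z_def)
  ultimately have "((\<lambda>t. - k * ln (pos_root k (- t)) + 1/2 * (pos_root k t)\<^sup>2) has_real_derivative
      - k * (1 / s * - (s / (s + z))) + 1/2 * (2 * (z / (s + z) * z))) (at t)"
    by (intro DERIV_add DERIV_cmult)
  also have "- k * (1 / s * - (s / (s + z))) = k / (s + z)"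
    using \<open>s > 0\<close> by simp
  also have "1/2 * (2 * (z / (s + z) * z)) = z * z / (s + z)"
    by simp
  also have "k / (s + z) + z * z / (s + z) = (k + z * z) / (s + z)"
    by (simp only: add_divide_distrib)
  also have "k + z * z = z * (s + z)"
    using pos_root_mult[of t] by (simp add: s_def z_def algebra_simps)
  also have "z * (s + z) / (s + z) = z"
    using \<open>s > 0\<close> \<open>z > 0\<close> by simp
  finally show ?thesis by (simp add: z_def)
qed

lemma strict_mono_pos_root: "strict_mono (pos_root k)"
proof (rule strict_monoI)
  fix t u :: real assume "t < u"
  then show "pos_root k t < pos_root k u"
  proof (rule DERIV_pos_imp_increasing)
    show "\<exists>d. (pos_root k has_real_derivative d) (at w) \<and> 0 < d" for w
      using has_real_derivative_pos_root[of w] divide_pos_pos[OF pos_root_pos pos_root_sum_pos]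
      by blast
  qed
qed

lemma continuous_on_pos_root: "continuous_on S (pos_root k)"
  using k by (auto simp: pos_root_def[abs_def] intro!: continuous_intros)

end

section \<open>The SBAL function in each of its two variables\<close>

text \<open>This presents functions of single coordinates as ridge functions along the columns of
  the identity, so the results above apply in the variable \<open>x\<close>.\<close>

lemma column_mat_1_inner: "column i (mat 1) \<bullet> (x :: real ^ 'n) = x $ i"
  by (simp add: column_def mat_def inner_vec_def if_distrib[of "\<lambda>y. y * _"] cong: if_cong)

theorem lemma2p1:
  fixes A :: "real ^ 'n ^ 'm" and b :: "real ^ 'm" and c :: "real ^ 'n" and \<mu> \<rho> :: real
  assumes "rank A = CARD('m)" and "\<mu> > 0" and "\<rho> > 0"
  shows "let s = sbal_s A c \<mu> \<rho>; z = sbal_z A c \<mu> \<rho>; L = sbal_L A b c \<mu> \<rho>;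
             S = (\<lambda>y x. diag_matrix (s y x)); Z = (\<lambda>y x. diag_matrix (z y x))
    in (\<forall>y x.
          (\<lambda>(y, x). s y x) differentiable at (y, x) \<and>
          (\<lambda>(y, x). z y x) differentiable at (y, x) \<and>
          invertible (S y x + Z y x) \<and>
          has_gradient_matrix (\<lambda>y. s y x) (- (A ** matrix_inv (S y x + Z y x) ** S y x)) y \<and>
          has_gradient_matrix (\<lambda>y. z y x) (A ** matrix_inv (S y x + Z y x) ** Z y x) y \<and>
          has_gradient_matrix (\<lambda>x. s y x) ((- \<rho>) *\<^sub>R (matrix_inv (S y x + Z y x) ** S y x)) x \<and>
          has_gradient_matrix (\<lambda>x. z y x) (\<rho> *\<^sub>R (matrix_inv (S y x + Z y x) ** Z y x)) x)
     \<and> (\<forall>x.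
          twice_continuously_differentiable (\<lambda>y. L y x) \<and>
          (\<forall>y. GDERIV (\<lambda>y. L y x) y :> (A *v z y x - \<rho> *\<^sub>R b)) \<and>
          (\<forall>y. has_hessian (\<lambda>y. L y x)
                 (A ** matrix_inv (S y x + Z y x) ** Z y x ** transpose A) y) \<and>
          strictly_convex_on UNIV (\<lambda>y. L y x))
     \<and> (\<forall>y.
          twice_continuously_differentiable (\<lambda>x. L y x) \<and>
          strictly_concave_on UNIV (\<lambda>x. L y x) \<and>
          (\<forall>x. GDERIV (\<lambda>x. L y x) x :> (\<rho> *\<^sub>R (s y x - c + transpose A *v y))) \<and>
          (\<forall>x. has_hessian (\<lambda>x. L y x)
                 ((- (\<rho>^2)) *\<^sub>R (matrix_inv (S y x + Z y x) ** S y x)) x))"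
proof -
  define k where "k = \<rho> * \<mu>"
  have k: "k > 0" using assms by (simp add: k_def)
  define a where "a i = column i A" for i
  define t where "t y x i = \<rho> * x $ i - c $ i + a i \<bullet> y" for y x i
  define s z L where "s = sbal_s A c \<mu> \<rho>" and "z = sbal_z A c \<mu> \<rho>" and "L = sbal_L A b c \<mu> \<rho>"
  define S Z where "S y x = diag_matrix (s y x)" and "Z y x = diag_matrix (z y x)" for y x
  \<comment> \<open>At \<open>u = t y x i\<close> these are the diagonal entries of the inverse of
    \<open>S + Z\<close> times \<open>S\<close> and times \<open>Z\<close>.\<close>
  define ws wz where "ws u = pos_root k (- u) / (pos_root k (- u) + pos_root k u)"
    and "wz u = pos_root k u / (pos_root k (- u) + pos_root k u)" for u
  define \<phi> where "\<phi> u = - k * ln (pos_root k (- u)) + 1/2 * (pos_root k u)\<^sup>2" for u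

  have s_eq: "s y x = (\<chi> i. pos_root k (- t y x i))" and z_eq: "z y x = (\<chi> i. pos_root k (t y x i))"
    for y x
    unfolding s_def z_def sbal_s_def sbal_z_def pos_root_uminus t_def a_def k_def
    by (simp_all add: pos_root_def mult.assoc)
  have L_eq: "L y x = - \<rho> * (b \<bullet> y) + (\<Sum>i\<in>UNIV. \<phi> (t y x i) - 1/2 * \<rho>\<^sup>2 * (x $ i)\<^sup>2)" for y x
    unfolding L_def sbal_L_def \<phi>_def s_def[symmetric] z_def[symmetric] s_eq z_eq k_def
    by simp

  note sum_pos = pos_root_sum_pos[OF k]
  have SZ: "S y x + Z y x = diag_matrix (s y x + z y x)" for y x
    by (simp add: S_def Z_def diag_matrix_add)
  have nz: "(s y x + z y x) $ i \<noteq> 0" for y x i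
    using sum_pos[of "t y x i"] by (simp add: s_eq z_eq)
  have inv: "invertible (S y x + Z y x)" for y x
    unfolding SZ by (rule diag_matrix_inverse(1)[OF nz])
  have invS: "matrix_inv (S y x + Z y x) ** S y x = diag_matrix (\<chi> i. ws (t y x i))"
    and invZ: "matrix_inv (S y x + Z y x) ** Z y x = diag_matrix (\<chi> i. wz (t y x i))" for y x
    unfolding SZ diag_matrix_inverse(2)[OF nz] unfolding S_def Z_def diag_matrix_mult
    by (simp_all add: s_eq z_eq ws_def wz_def field_simps)

  have dz: "(pos_root k has_real_derivative wz u) (at u)"
    and ds: "((\<lambda>u. pos_root k (- u)) has_real_derivative - ws u) (at u)"
    and d\<phi>: "(\<phi> has_real_derivative pos_root k u) (at u)" for u
    unfolding wz_def ws_def \<phi>_def[abs_def]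
    by (rule has_real_derivative_pos_root[OF k] has_real_derivative_pos_root_uminus[OF k]
        has_real_derivative_barrier[OF k])+
  have cont: "continuous_on UNIV ws" "continuous_on UNIV wz"
  proof -
    have "continuous_on UNIV (\<lambda>u. pos_root k (- u))"
      by (rule continuous_on_compose2[OF continuous_on_pos_root[OF k]])
        (auto intro!: continuous_intros)
    then show "continuous_on UNIV ws" "continuous_on UNIV wz"
      unfolding ws_def[abs_def] wz_def[abs_def]
      using sum_pos by (auto intro!: continuous_intros continuous_on_pos_root[OF k] simp: less_imp_neq[THEN not_sym])
  qed

  \<comment> \<open>Chain rules for the two ways in which \<open>t\<close> varies: with slope 1 in
    the inner product of \<open>y\<close> with a column, and with slope \<open>\<rho>\<close> in a
    coordinate of \<open>x\<close>.\<close>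
  have shiftd: "((\<lambda>u. f (e + u)) has_real_derivative D (e + u)) (at u)"
    if "\<And>u. (f has_real_derivative D u) (at u)" for f D e u
    using DERIV_chain2[OF that DERIV_add[OF DERIV_const[of e] DERIV_ident]] by simp
  have affd: "((\<lambda>u. f (\<rho> * u - d + e)) has_real_derivative D (\<rho> * u - d + e) * \<rho>) (at u)"
    if "\<And>u. (f has_real_derivative D u) (at u)" for f D d e u
    by (rule DERIV_chain2[OF that]) (auto intro!: derivative_eq_intros)

  \<comment> \<open>Differentiability jointly in the pair, which the separate gradient matrices
    would not give: each \<open>t y x i\<close> is affine in \<open>(y, x)\<close>, and vector
    functions are treated componentwise.\<close>
  have diff: "(\<lambda>(y, x). \<chi> i. f (t y x i)) differentiable at (y, x)"
    if "\<And>u. (f has_real_derivative D u) (at u)" for f D y x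
  proof -
    have "((\<lambda>p. t (fst p) (snd p) i) has_derivative (\<lambda>p. \<rho> * snd p $ i + a i \<bullet> fst p)) (at (y, x))" for i
      unfolding t_def by (auto intro!: derivative_eq_intros bounded_linear.has_derivative[OF bounded_linear_vec_nth])
    then have "(\<lambda>p. f (t (fst p) (snd p) i)) differentiable at (y, x)" for i
      by (rule differentiableI[OF DERIV_compose_FDERIV[OF that]])
    then have "(\<lambda>p. \<chi> i. f (t (fst p) (snd p) i)) differentiable at (y, x)"
      by (subst differentiable_componentwise_within) (auto simp: Basis_vec_def inner_axis)
    then show ?thesis by (simp add: case_prod_unfold)
  qed

  have 1: "(\<lambda>(y, x). s y x) differentiable at (y, x) \<and>
      (\<lambda>(y, x). z y x) differentiable at (y, x) \<and>
      invertible (S y x + Z y x) \<and>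
      has_gradient_matrix (\<lambda>y. s y x) (- (A ** matrix_inv (S y x + Z y x) ** S y x)) y \<and>
      has_gradient_matrix (\<lambda>y. z y x) (A ** matrix_inv (S y x + Z y x) ** Z y x) y \<and>
      has_gradient_matrix (\<lambda>x. s y x) ((- \<rho>) *\<^sub>R (matrix_inv (S y x + Z y x) ** S y x)) x \<and>
      has_gradient_matrix (\<lambda>x. z y x) (\<rho> *\<^sub>R (matrix_inv (S y x + Z y x) ** Z y x)) x" for y x
  proof (intro conjI inv)
    show "(\<lambda>(y, x). s y x) differentiable at (y, x)" "(\<lambda>(y, x). z y x) differentiable at (y, x)"
      unfolding s_eq z_eq by (rule diff[OF ds] diff[OF dz])+
    have "has_gradient_matrix (\<lambda>y. s y x) (A ** diag_matrix (\<chi> i. - ws (t y x i))) y"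
      unfolding s_eq t_def a_def
      by (rule has_gradient_matrix_ridge) (simp only: vec_lambda_beta, rule shiftd[OF ds])
    moreover have "A ** diag_matrix (\<chi> i. - ws (t y x i)) = - (A ** diag_matrix (\<chi> i. ws (t y x i)))"
      by (simp add: vec_eq_iff matrix_matrix_mult_def diag_matrix_def if_distrib[of "\<lambda>x. _ * x"] cong: if_cong)
    ultimately show "has_gradient_matrix (\<lambda>y. s y x) (- (A ** matrix_inv (S y x + Z y x) ** S y x)) y"
      unfolding matrix_mul_assoc[symmetric] invS by simp
    show "has_gradient_matrix (\<lambda>y. z y x) (A ** matrix_inv (S y x + Z y x) ** Z y x) y"
      unfolding matrix_mul_assoc[symmetric] invZ unfolding z_eq t_def a_def
      by (rule has_gradient_matrix_ridge) (simp only: vec_lambda_beta, rule shiftd[OF dz])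
    \<comment> \<open>The coordinate \<open>x $ i\<close> is written as an inner product with a
      column of \<open>mat 1\<close> to match the ridge form. The inner slope supplies the factor
      \<open>\<rho>\<close>.\<close>
    have "has_gradient_matrix (\<lambda>x. \<chi> i. pos_root k (- (\<rho> * (column i (mat 1) \<bullet> x) - c $ i + a i \<bullet> y)))
        (mat 1 ** diag_matrix (\<chi> i. - ws (\<rho> * (column i (mat 1) \<bullet> x) - c $ i + a i \<bullet> y) * \<rho>)) x"
      by (rule has_gradient_matrix_ridge) (simp only: vec_lambda_beta, rule affd[OF ds])
    then show "has_gradient_matrix (\<lambda>x. s y x) ((- \<rho>) *\<^sub>R (matrix_inv (S y x + Z y x) ** S y x)) x"
      unfolding invS s_eq t_def scaleR_diag_matrix column_mat_1_inner
      by (simp add: scaleR_vec_def mult.commute)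
    have "has_gradient_matrix (\<lambda>x. \<chi> i. pos_root k (\<rho> * (column i (mat 1) \<bullet> x) - c $ i + a i \<bullet> y))
        (mat 1 ** diag_matrix (\<chi> i. wz (\<rho> * (column i (mat 1) \<bullet> x) - c $ i + a i \<bullet> y) * \<rho>)) x"
      by (rule has_gradient_matrix_ridge) (simp only: vec_lambda_beta, rule affd[OF dz])
    then show "has_gradient_matrix (\<lambda>x. z y x) (\<rho> *\<^sub>R (matrix_inv (S y x + Z y x) ** Z y x)) x"
      unfolding invZ z_eq t_def scaleR_diag_matrix column_mat_1_inner
      by (simp add: scaleR_vec_def mult.commute)
  qed

  have 2: "twice_continuously_differentiable (\<lambda>y. L y x) \<and>
      (\<forall>y. GDERIV (\<lambda>y. L y x) y :> (A *v z y x - \<rho> *\<^sub>R b)) \<and>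
      (\<forall>y. has_hessian (\<lambda>y. L y x) (A ** matrix_inv (S y x + Z y x) ** Z y x ** transpose A) y) \<and>
      strictly_convex_on UNIV (\<lambda>y. L y x)" for x
  proof -
    define e where "e i = \<rho> * x $ i - c $ i" for i
    have t: "t y x i = e i + column i A \<bullet> y" for y i by (simp add: t_def e_def a_def)
    \<comment> \<open>For fixed \<open>x\<close> the quadratic terms in \<open>x\<close> are
      constant.\<close>
    define C where "C = - (\<Sum>i\<in>UNIV. 1/2 * \<rho>\<^sup>2 * (x $ i)\<^sup>2)"
    have L: "(\<lambda>y. L y x) = ridge_sum A (- \<rho> *\<^sub>R b) C (\<lambda>i u. \<phi> (e i + u))"
      by (simp add: fun_eq_iff L_eq ridge_sum_def C_def t sum_subtractf)
    note g = shiftd[OF d\<phi>] and g' = shiftd[OF dz]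
    have "continuous_on UNIV (\<lambda>u. wz (e i + u))" for i
      by (rule continuous_on_compose2[OF cont(2)]) (auto intro!: continuous_intros)
    then have "twice_continuously_differentiable (\<lambda>y. L y x)"
      unfolding L by (rule twice_continuously_differentiable_ridge_sum[OF g g'])
    moreover have "GDERIV (\<lambda>y. L y x) y :> (A *v z y x - \<rho> *\<^sub>R b)" for y
      using GDERIV_ridge_sum[OF g, of A "- \<rho> *\<^sub>R b" C e y] unfolding L z_eq t by simp
    moreover have "has_hessian (\<lambda>y. L y x) (A ** matrix_inv (S y x + Z y x) ** Z y x ** transpose A) y" for y
      using has_hessian_ridge_sum[OF g g', of A "- \<rho> *\<^sub>R b" C e y]
      unfolding L matrix_mul_assoc[symmetric, of A] invZ t by simp
    moreover have "strictly_convex_on UNIV (\<lambda>u. \<phi> (e i + u))" for i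
      by (rule strictly_convex_on_UNIV_deriv[OF g])
        (use strict_monoD[OF strict_mono_pos_root[OF k]] in \<open>auto intro: strict_monoI\<close>)
    \<comment> \<open>The rank hypothesis on \<open>A\<close> enters here, to separate points by its
      columns.\<close>
    then have "strictly_convex_on UNIV (\<lambda>y. L y x)"
      unfolding L by (rule strictly_convex_on_ridge_sum[OF _ assms(1)])
    ultimately show ?thesis by blast
  qed

  have 3: "twice_continuously_differentiable (\<lambda>x. L y x) \<and>
      strictly_concave_on UNIV (\<lambda>x. L y x) \<and>
      (\<forall>x. GDERIV (\<lambda>x. L y x) x :> (\<rho> *\<^sub>R (s y x - c + transpose A *v y))) \<and>
      (\<forall>x. has_hessian (\<lambda>x. L y x) ((- (\<rho>^2)) *\<^sub>R (matrix_inv (S y x + Z y x) ** S y x)) x)" for y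
  proof -
    define \<tau> where "\<tau> i u = \<rho> * u - c $ i + a i \<bullet> y" for i u
    define g where "g i u = \<phi> (\<tau> i u) - 1/2 * \<rho>\<^sup>2 * u\<^sup>2" for i u
    \<comment> \<open>Differentiating \<open>g\<close> directly gives \<open>\<rho>\<close> times
      \<open>z - \<rho> * u\<close>. Since \<open>z - s\<close> equals \<open>\<tau> i u\<close>,
      this is the stated form in terms of \<open>s\<close>.\<close>
    define g' where "g' i u = \<rho> * (pos_root k (- \<tau> i u) - c $ i + a i \<bullet> y)" for i u
    define g'' where "g'' i u = - (\<rho>\<^sup>2) * ws (\<tau> i u)" for i u
    have t: "t y x i = \<tau> i (x $ i)" for x i by (simp add: t_def \<tau>_def)
    have L: "(\<lambda>x. L y x) = ridge_sum (mat 1) 0 (- \<rho> * (b \<bullet> y)) g"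
      by (simp add: fun_eq_iff L_eq ridge_sum_def t g_def column_mat_1_inner)
    have z_minus_s: "pos_root k u - pos_root k (- u) = u" for u
      by (simp add: pos_root_def field_simps)
    have g: "(g i has_real_derivative g' i u) (at u)" for i u
    proof -
      have "(g i has_real_derivative pos_root k (\<tau> i u) * \<rho> - 1/2 * \<rho>\<^sup>2 * (2 * u)) (at u)"
        unfolding g_def[abs_def] \<tau>_def
        by (intro DERIV_diff affd[OF d\<phi>] DERIV_cmult) (auto intro!: derivative_eq_intros)
      moreover have "pos_root k (\<tau> i u) = pos_root k (- \<tau> i u) + (\<rho> * u - c $ i + a i \<bullet> y)"
        using z_minus_s[of "\<tau> i u"] by (simp add: \<tau>_def)
      ultimately show ?thesis by (simp add: g'_def algebra_simps power2_eq_square)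
    qed
    have g': "(g' i has_real_derivative g'' i u) (at u)" for i u
      unfolding g'_def[abs_def] g''_def \<tau>_def
      by (rule derivative_eq_intros affd[OF ds] refl)+ (simp add: power2_eq_square)
    have "continuous_on UNIV (g'' i)" for i
      unfolding g''_def[abs_def] \<tau>_def
      by (intro continuous_intros continuous_on_compose2[OF cont(1)]) auto
    then have "twice_continuously_differentiable (\<lambda>x. L y x)"
      unfolding L by (rule twice_continuously_differentiable_ridge_sum[OF g g'])
    moreover have "GDERIV (\<lambda>x. L y x) x :> (\<rho> *\<^sub>R (s y x - c + transpose A *v y))" for x
    proof -
      have "0 + mat 1 *v (\<chi> i. g' i (column i (mat 1) \<bullet> x)) = \<rho> *\<^sub>R (s y x - c + transpose A *v y)"
        unfolding column_mat_1_inner matrix_vector_mul_lid vec_eq_iff vector_add_component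
          vector_scaleR_component vector_minus_component transpose_mult_vec_nth
        by (simp add: s_eq t g'_def a_def)
      then show ?thesis unfolding L by (rule subst) (rule GDERIV_ridge_sum[OF g])
    qed
    moreover have "has_hessian (\<lambda>x. L y x) ((- (\<rho>^2)) *\<^sub>R (matrix_inv (S y x + Z y x) ** S y x)) x" for x
    proof -
      have "mat 1 ** diag_matrix (\<chi> i. g'' i (column i (mat 1) \<bullet> x)) ** transpose (mat 1) =
          (- (\<rho>^2)) *\<^sub>R (matrix_inv (S y x + Z y x) ** S y x)"
        unfolding invS scaleR_diag_matrix
        by (simp add: transpose_mat t g''_def column_mat_1_inner scaleR_vec_def)
      then show ?thesis unfolding L by (rule subst) (rule has_hessian_ridge_sum[OF g g'])
    qed
    moreover have "strictly_concave_on UNIV (\<lambda>x. L y x)"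
    proof -
      \<comment> \<open>The negated function is again a ridge sum, so concavity reduces to the
        convexity lemma.\<close>
      have neg: "(\<lambda>x. - L y x) = ridge_sum (mat 1) 0 (\<rho> * (b \<bullet> y)) (\<lambda>i u. - g i u)"
        using fun_cong[OF L] by (simp add: fun_eq_iff ridge_sum_def sum_negf)
      \<comment> \<open>As \<open>\<rho>\<close> is positive, \<open>\<tau> i\<close> increases, so
        the root at \<open>- \<tau> i u\<close> strictly decreases in \<open>u\<close>.\<close>
      have "strict_mono (\<lambda>u. - g' i u)" for i
        using strict_monoD[OF strict_mono_pos_root[OF k]] assms(3)
        by (intro strict_monoI) (simp add: g'_def \<tau>_def)
      then have "strictly_convex_on UNIV (\<lambda>u. - g i u)" for i
        by (rule strictly_convex_on_UNIV_deriv[OF DERIV_minus[OF g]])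
      then show ?thesis
        unfolding strictly_concave_on_def neg by (rule strictly_convex_on_ridge_sum[OF _ rank_I])
    qed
    ultimately show ?thesis by blast
  qed

  show ?thesis
    using 1 2 3 unfolding Let_def s_def z_def L_def S_def Z_def by blast
qed

end
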